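(* For any $r>0$ and $x\in H$, the metric projection $P_{B_M(r)}:H\to B_M(r)$ satisfies: (a) $P_{B_M(r)}(x)=x$, for $x\in B_M(r)$; (b) $P_{B_M(r)}(x)=\dfrac{r}{\|x\|}x$, for $x\in H_M\setminus B_M(r)$; (c) $P_{B_M(r)}(x)=x_M$, for $x\in C_M(r)\setminus H_M$; (d) $P_{B_M(r)}(x)=\dfrac{r}{\|x_M\|}x_M$, for $x\in H\setminus(C_M(r)\cup H_M)$.
   Context: $(H,\|\cdot\|)$ is a real Hilbert space with inner product $\langle\cdot,\cdot\rangle$ and an orthonormal basis $\{e_n\}_{n\in N}$, where $N$ is a set of positive integers with cardinality greater than $1$. $M$ is a nonempty subset of $N$, $H_M$ is the closed subspace of $H$ generated by $\{e_m\}_{m\in M}$, and for $x\in H$, $x_M=\sum_{m\in M}\langle x,e_m\rangle e_m\in H_M$. For $r>0$, $B_M(r)=\{x\in H_M:\|x\|\le r\}$ and $C_M(r)=\{x\in H:x_M\in B_M(r)\}$. For a nonempty closed convex $C\subseteq H$, $P_C:H\to C$ is the metric projection: $P_Cx$ is the unique point of $C$ nearest to $x$. *)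

theory Defs
  imports "HOL-Analysis.Analysis"
begin

text \<open>A real Hilbert space is a type of sort \<open>{real_inner, complete_space}\<close>.  The index set \<open>N\<close> may be
  finite or infinite.\<close>

definition orthonormal_basis :: "nat set \<Rightarrow> (nat \<Rightarrow> 'a::{real_inner, complete_space}) \<Rightarrow> bool" where
  "orthonormal_basis N e \<longleftrightarrow>
     (\<forall>m\<in>N. \<forall>n\<in>N. e m \<bullet> e n = (if m = n then 1 else 0)) \<and>
     closure (span (e ` N)) = UNIV"

definition closed_subspace_gen ::
    "(nat \<Rightarrow> 'a::{real_inner, complete_space}) \<Rightarrow> nat set \<Rightarrow> 'a set" where
  "closed_subspace_gen e M = closure (span (e ` M))"

text \<open>The vector written \<open>x\<^sub>M\<close>, a norm-convergent unordered sum when \<open>M\<close> is infinite.\<close>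

definition component ::
    "(nat \<Rightarrow> 'a::{real_inner, complete_space}) \<Rightarrow> nat set \<Rightarrow> 'a \<Rightarrow> 'a" where
  "component e M x = (\<Sum>\<^sub>\<infinity>m\<in>M. (x \<bullet> e m) *\<^sub>R e m)"

definition ball_in ::
    "(nat \<Rightarrow> 'a::{real_inner, complete_space}) \<Rightarrow> nat set \<Rightarrow> real \<Rightarrow> 'a set" where
  "ball_in e M r = {x \<in> closed_subspace_gen e M. norm x \<le> r}"

definition cylinder ::
    "(nat \<Rightarrow> 'a::{real_inner, complete_space}) \<Rightarrow> nat set \<Rightarrow> real \<Rightarrow> 'a set" where
  "cylinder e M r = {x. component e M x \<in> ball_in e M r}"

text \<open>The library's \<open>closest_point\<close> requires the Heine-Borel property and hence finite dimension.
  The description below is proper for nonempty closed convex sets, see \<open>metric_projection_ex1\<close>.\<close>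

definition metric_projection :: "'a::{real_inner, complete_space} set \<Rightarrow> 'a \<Rightarrow> 'a" where
  "metric_projection C x = (THE y. y \<in> C \<and> (\<forall>z\<in>C. norm (x - y) \<le> norm (x - z)))"

lemma near_points_close:
  fixes x y z :: "'a::real_inner"
  assumes "convex C" "y \<in> C" "z \<in> C" and d: "0 \<le> d" "\<And>w. w \<in> C \<Longrightarrow> d \<le> norm (x - w)"
    and "norm (x - y) \<le> s" "norm (x - z) \<le> s"
  shows "(norm (y - z))\<^sup>2 \<le> 4 * s\<^sup>2 - 4 * d\<^sup>2"
proof -
  let ?w = "(1/2) *\<^sub>R y + (1/2) *\<^sub>R z"
  have "?w \<in> C"
    using assms(1-3) by (intro convexD) auto
  then have "d\<^sup>2 \<le> (norm (x - ?w))\<^sup>2"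
    using d by (intro power_mono) auto
  moreover have "(norm (y - z))\<^sup>2 = 2 * (norm (x - y))\<^sup>2 + 2 * (norm (x - z))\<^sup>2 - 4 * (norm (x - ?w))\<^sup>2"
    unfolding power2_norm_eq_inner by (simp add: algebra_simps inner_commute)
  moreover have "(norm (x - y))\<^sup>2 \<le> s\<^sup>2" "(norm (x - z))\<^sup>2 \<le> s\<^sup>2"
    using assms by (auto intro!: power_mono)
  ultimately show ?thesis by linarith
qed

lemma metric_projection_ex1:
  fixes C :: "'a::{real_inner, complete_space} set"
  assumes "C \<noteq> {}" "closed C" "convex C"
  shows "\<exists>!y. y \<in> C \<and> (\<forall>z\<in>C. norm (x - y) \<le> norm (x - z))"
proof -
  define d where "d = infdist x C"
  have d: "0 \<le> d" "\<And>w. w \<in> C \<Longrightarrow> d \<le> norm (x - w)"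
    unfolding d_def using infdist_le[of _ C x] by (auto simp: infdist_nonneg dist_norm)
  define S where "S n = C \<inter> cball x (d + 1 / real (Suc n))" for n
  have "\<exists>a. \<forall>n. a \<in> S n"
  proof (rule decreasing_closed_nest)
    show "closed (S n)" for n
      unfolding S_def using assms by auto
    show "S n \<noteq> {}" for n
    proof -
      have "\<exists>y\<in>C. dist x y < d + 1 / real (Suc n)"
        using assms(1) unfolding d_def infdist_def
        by (subst cINF_less_iff[symmetric]) auto
      then show ?thesis
        unfolding S_def by force
    qed
    show "S n \<subseteq> S m" if "m \<le> n" for m n
    proof -
      have "1 / real (Suc n) \<le> 1 / real (Suc m)"
        using that by (intro divide_left_mono) auto
      then show ?thesis
        unfolding S_def by force
    qed
    show "\<exists>n. \<forall>y\<in>S n. \<forall>z\<in>S n. dist y z < \<epsilon>" if "0 < \<epsilon>" for \<epsilon>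
    proof -
      have "(\<lambda>n. 4 * (d + 1 / real (Suc n))\<^sup>2 - 4 * d\<^sup>2) \<longlonglongrightarrow> 4 * (d + 0)\<^sup>2 - 4 * d\<^sup>2"
        by (intro tendsto_intros LIMSEQ_Suc[OF lim_1_over_n])
      then have "eventually (\<lambda>n. 4 * (d + 1 / real (Suc n))\<^sup>2 - 4 * d\<^sup>2 < \<epsilon>\<^sup>2) sequentially"
        using that by (intro order_tendstoD) auto
      then obtain n where n: "4 * (d + 1 / real (Suc n))\<^sup>2 - 4 * d\<^sup>2 < \<epsilon>\<^sup>2"
        by (auto simp: eventually_sequentially)
      have "dist y z < \<epsilon>" if "y \<in> S n" "z \<in> S n" for y z
      proof -
        have "(norm (y - z))\<^sup>2 \<le> 4 * (d + 1 / real (Suc n))\<^sup>2 - 4 * d\<^sup>2"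
          using that d by (intro near_points_close[OF assms(3), where x = x])
            (auto simp: S_def dist_norm)
        then have "(norm (y - z))\<^sup>2 < \<epsilon>\<^sup>2" using n by linarith
        then show ?thesis
          using \<open>0 < \<epsilon>\<close> by (simp add: dist_norm power_less_imp_less_base)
      qed
      then show ?thesis by blast
    qed
  qed blast
  then obtain a where a: "\<And>n. a \<in> S n" by blast
  then have "norm (x - a) \<le> d + 1 / real (Suc n)" for n
    by (auto simp: S_def dist_norm)
  moreover have "(\<lambda>n. d + 1 / real (Suc n)) \<longlonglongrightarrow> d + 0"
    by (intro tendsto_intros LIMSEQ_Suc[OF lim_1_over_n])
  ultimately have "norm (x - a) \<le> d"
    using LIMSEQ_le_const[of "\<lambda>n. d + 1 / real (Suc n)" d "norm (x - a)"] by auto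
  with a d have "a \<in> C \<and> (\<forall>z\<in>C. norm (x - a) \<le> norm (x - z))"
    by (force simp: S_def)
  moreover have "y = z"
    if "y \<in> C" "\<forall>w\<in>C. norm (x - y) \<le> norm (x - w)"
      and "z \<in> C" "\<forall>w\<in>C. norm (x - z) \<le> norm (x - w)" for y z
    using near_points_close[OF assms(3) that(1,3), of "norm (x - y)" x "norm (x - y)"] that
    by auto
  ultimately show ?thesis by blast
qed

lemma ball_in_closed_convex:
  assumes "0 \<le> r"
  shows "ball_in e M r \<noteq> {}" "closed (ball_in e M r)" "convex (ball_in e M r)"
proof -
  have eq: "ball_in e M r = closure (span (e ` M)) \<inter> cball 0 r"
    by (auto simp: ball_in_def closed_subspace_gen_def)
  have "0 \<in> closure (span (e ` M))"
    using span_zero closure_subset by blast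
  with assms show "ball_in e M r \<noteq> {}"
    by (auto simp: ball_in_def closed_subspace_gen_def intro!: exI[of _ 0])
  show "closed (ball_in e M r)" "convex (ball_in e M r)"
    unfolding eq by (blast intro: closed_Int convex_Int convex_closure subspace_imp_convex
        subspace_span closed_closure closed_cball convex_cball)+
qed

end

theory Submission
  imports Defs
begin

text \<open>The metric projection onto \<open>H\<^sub>M\<close> is the orthogonal projection, which equals \<open>x\<^sub>M\<close>; it sends
  \<open>x\<close> to a point \<open>p\<close> with \<open>x - p \<bottom> H\<^sub>M\<close>.  Hence the nearest point of \<open>B\<^sub>M(r)\<close> to \<open>x\<close> is the nearest
  one to \<open>p\<close>, which is \<open>p\<close> itself or its radial truncation, by the variational inequality
  \<open>(x - y) \<bullet> (z - y) \<le> 0\<close> and Cauchy-Schwarz.\<close>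

text \<open>Expanding the square turns the obtuse-angle condition into \<open>le\<close>. Dropping
  the term \<open>(norm (z - y))\<^sup>2\<close> shows that \<open>y\<close> is nearest; keeping it
  forces any other nearest point to equal \<open>y\<close>, the uniqueness that the definite
  description demands.\<close>

lemma metric_projection_eqI:
  fixes x y :: "'a::{real_inner, complete_space}"
  assumes "y \<in> C" and obtuse: "\<And>z. z \<in> C \<Longrightarrow> (x - y) \<bullet> (z - y) \<le> 0"
  shows "metric_projection C x = y"
proof -
  have le: "(norm (x - y))\<^sup>2 + (norm (z - y))\<^sup>2 \<le> (norm (x - z))\<^sup>2" if "z \<in> C" for z
    using obtuse[OF that] unfolding power2_norm_eq_inner
    by (simp add: algebra_simps inner_commute)
  have near: "norm (x - y) \<le> norm (x - z)" if "z \<in> C" for z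
  proof (rule power2_le_imp_le)
    show "(norm (x - y))\<^sup>2 \<le> (norm (x - z))\<^sup>2"
      using le[OF that] zero_le_power2[of "norm (z - y)"] by linarith
  qed simp
  show ?thesis
    unfolding metric_projection_def
  proof (rule the_equality)
    fix z assume z: "z \<in> C \<and> (\<forall>w\<in>C. norm (x - z) \<le> norm (x - w))"
    then have "(norm (x - z))\<^sup>2 \<le> (norm (x - y))\<^sup>2"
      using assms(1) by (intro power_mono) auto
    with le[of z] z have "(norm (z - y))\<^sup>2 \<le> 0" by linarith
    then show "z = y" by simp
  qed (use assms near in auto)
qed

lemma subspace_closure:
  fixes S :: "'a::real_normed_vector set"
  assumes "subspace S"
  shows "subspace (closure S)"
proof (rule subspaceI)
  show "0 \<in> closure S"
    using assms closure_subset subspace_0 by blast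
  show "x + y \<in> closure S" if "x \<in> closure S" "y \<in> closure S" for x y
  proof -
    from that obtain f g where "\<forall>n. f n \<in> S" "f \<longlonglongrightarrow> x" "\<forall>n. g n \<in> S" "g \<longlonglongrightarrow> y"
      unfolding closure_sequential by blast
    then show ?thesis
      unfolding closure_sequential using assms
      by (intro exI[of _ "\<lambda>n. f n + g n"]) (auto intro: tendsto_add subspace_add)
  qed
  show "c *\<^sub>R x \<in> closure S" if "x \<in> closure S" for c x
  proof -
    from that obtain f where "\<forall>n. f n \<in> S" "f \<longlonglongrightarrow> x"
      unfolding closure_sequential by blast
    then show ?thesis
      unfolding closure_sequential using assms
      by (intro exI[of _ "\<lambda>n. c *\<^sub>R f n"]) (auto intro: tendsto_scaleR subspace_scale)
  qed
qed

text \<open>The orthogonal complement of \<open>w\<close> is a closed subspace, so once it contains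
  \<open>B\<close> it contains the closed span.\<close>

lemma inner_closure_span_eq_0:
  fixes w :: "'a::real_inner"
  assumes "\<And>b. b \<in> B \<Longrightarrow> w \<bullet> b = 0" "v \<in> closure (span B)"
  shows "w \<bullet> v = 0"
proof -
  have "span B \<subseteq> {v. w \<bullet> v = 0}"
    using assms(1) by (intro span_minimal) (auto simp: subspace_hyperplane)
  moreover have "closed {v. w \<bullet> v = 0}"
    by (rule closed_hyperplane)
  ultimately show ?thesis
    using assms(2) closure_minimal by blast
qed

text \<open>Completeness provides a nearest point \<open>p\<close> in the closed span. Its
  minimality along the line through \<open>p\<close> in each direction \<open>b\<close> makes
  \<open>x - p\<close> orthogonal to \<open>B\<close>, hence to the closed span.\<close>

lemma ex_orthogonal_projection:
  fixes x :: "'a::{real_inner, complete_space}"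
  assumes unit: "\<And>b. b \<in> B \<Longrightarrow> norm b = 1"
  shows "\<exists>p\<in>closure (span B). \<forall>v\<in>closure (span B). (x - p) \<bullet> v = 0"
proof -
  let ?S = "closure (span B)"
  have sub: "subspace ?S" by (simp add: subspace_closure)
  then have "\<exists>!p. p \<in> ?S \<and> (\<forall>z\<in>?S. norm (x - p) \<le> norm (x - z))"
    by (intro metric_projection_ex1) (auto simp: subspace_imp_convex dest: subspace_0)
  then obtain p where p: "p \<in> ?S" "\<And>z. z \<in> ?S \<Longrightarrow> norm (x - p) \<le> norm (x - z)" by blast
  have "(x - p) \<bullet> b = 0" if b: "b \<in> B" for b
  proof -
    \<comment> \<open>Since \<open>b\<close> is a unit vector, this \<open>t\<close> minimises the
      distance from \<open>x\<close> to \<open>p + t *\<^sub>R b\<close>. The squared distance drops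
      by exactly \<open>t\<^sup>2\<close>, so minimality of \<open>p\<close> leaves only
      \<open>t = 0\<close>.\<close>
    define t where "t = (x - p) \<bullet> b"
    have "b \<in> ?S" using b closure_subset span_base by blast
    then have "p + t *\<^sub>R b \<in> ?S"
      using sub p by (auto intro: subspace_add subspace_scale)
    then have "(norm (x - p))\<^sup>2 \<le> (norm ((x - p) - t *\<^sub>R b))\<^sup>2"
      using p(2)[of "p + t *\<^sub>R b"] by (intro power_mono) (auto simp: algebra_simps)
    also have "\<dots> = (norm (x - p))\<^sup>2 - 2 * t * ((x - p) \<bullet> b) + t\<^sup>2 * (b \<bullet> b)"
      unfolding power2_norm_eq_inner
      by (simp add: inner_diff inner_commute power2_eq_square algebra_simps)
    also have "\<dots> = (norm (x - p))\<^sup>2 - t\<^sup>2"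
      using unit[OF b] by (simp add: norm_eq_1 t_def[symmetric] power2_eq_square)
    finally show ?thesis by (simp add: t_def)
  qed
  with p(1) inner_closure_span_eq_0 show ?thesis by blast
qed

text \<open>Every partial sum over \<open>G\<close> is the best approximation of \<open>p\<close> from \<open>span (e ` G)\<close>, so density of
  \<open>span (e ` M)\<close> gives convergence without prior knowledge of summability.\<close>
lemma has_sum_orthonormal_expansion:
  fixes e :: "'i \<Rightarrow> 'a::real_inner"
  assumes ortho: "\<And>m n. m \<in> M \<Longrightarrow> n \<in> M \<Longrightarrow> e m \<bullet> e n = (if m = n then 1 else 0)"
    and p: "p \<in> closure (span (e ` M))"
  shows "((\<lambda>m. (p \<bullet> e m) *\<^sub>R e m) has_sum p) M"
  unfolding has_sum_def tendsto_iff eventually_finite_subsets_at_top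
proof (intro allI impI)
  fix \<epsilon> :: real assume "\<epsilon> > 0"
  then obtain u where u: "u \<in> span (e ` M)" "dist u p < \<epsilon>"
    using p closure_approachable by blast
  then obtain T c where T: "finite T" "T \<subseteq> e ` M" "u = (\<Sum>a\<in>T. c a *\<^sub>R a)"
    unfolding span_explicit by auto
  from finite_subset_image[OF T(1,2)] obtain F where F: "F \<subseteq> M" "finite F" "T = e ` F"
    by blast
  \<comment> \<open>The approximant \<open>u\<close> involves only finitely many basis vectors;
    their index set \<open>F\<close> is the threshold beyond which all partial sums are within
    \<epsilon> of \<open>p\<close>.\<close>
  have uF: "u \<in> span (e ` F)"
    using T F by (auto intro: span_sum span_scale span_base)
  have "dist (\<Sum>m\<in>G. (p \<bullet> e m) *\<^sub>R e m) p < \<epsilon>" if G: "finite G" "F \<subseteq> G" "G \<subseteq> M" for G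
  proof -
    define q where "q = (\<Sum>m\<in>G. (p \<bullet> e m) *\<^sub>R e m)"
    have orth: "(p - q) \<bullet> e k = 0" if "k \<in> G" for k
    proof -
      have "q \<bullet> e k = (\<Sum>m\<in>G. if m = k then p \<bullet> e m else 0)"
        unfolding q_def inner_sum_left using G that by (intro sum.cong) (auto simp: ortho subset_iff)
      also have "\<dots> = p \<bullet> e k" using G that by simp
      finally show ?thesis by (simp add: inner_diff_left)
    qed
    have "q \<in> span (e ` G)"
      unfolding q_def by (intro span_sum span_scale span_base) auto
    moreover have "u \<in> span (e ` G)"
      using uF G span_mono[of "e ` F" "e ` G"] by blast
    ultimately have "q - u \<in> closure (span (e ` G))"
      using closure_subset span_diff by blast
    \<comment> \<open>This is the right angle for Pythagoras: \<open>q\<close> is at least as close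
      to \<open>p\<close> as \<open>u\<close> is.\<close>
    then have "(p - q) \<bullet> (q - u) = 0"
      by (rule inner_closure_span_eq_0[rotated]) (use orth in auto)
    then have "(norm (p - u))\<^sup>2 = (norm (p - q))\<^sup>2 + (norm (q - u))\<^sup>2"
      unfolding power2_norm_eq_inner by (simp add: algebra_simps inner_commute)
    then have "(norm (p - q))\<^sup>2 \<le> (norm (p - u))\<^sup>2"
      by simp
    then have "norm (p - q) \<le> norm (p - u)"
      by (rule power2_le_imp_le) simp
    then show ?thesis
      using u by (simp add: q_def dist_norm norm_minus_commute)
  qed
  with F show "\<exists>X. finite X \<and> X \<subseteq> M \<and> (\<forall>Y. finite Y \<and> X \<subseteq> Y \<and> Y \<subseteq> M \<longrightarrow>
      dist (\<Sum>m\<in>Y. (p \<bullet> e m) *\<^sub>R e m) p < \<epsilon>)"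
    by blast
qed

text \<open>The orthogonal projection \<open>p\<close> of \<open>x\<close> has the same coefficients
  as \<open>x\<close> on \<open>M\<close>, because \<open>x - p\<close> is orthogonal to every
  \<open>e m\<close>. So the series defining \<open>component\<close> is the expansion of
  \<open>p\<close>.\<close>

lemma component_orthogonal_projection:
  assumes "orthonormal_basis N e" "M \<subseteq> N"
  shows "component e M x \<in> closed_subspace_gen e M"
    and "v \<in> closed_subspace_gen e M \<Longrightarrow> (x - component e M x) \<bullet> v = 0"
proof -
  have ortho: "\<And>m n. m \<in> M \<Longrightarrow> n \<in> M \<Longrightarrow> e m \<bullet> e n = (if m = n then 1 else 0)"
    using assms by (auto simp: orthonormal_basis_def subset_iff)
  then have "norm b = 1" if "b \<in> e ` M" for b
    using that by (auto simp: norm_eq_1)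
  from ex_orthogonal_projection[of "e ` M" x, OF this]
  obtain p where p: "p \<in> closure (span (e ` M))"
      "\<And>v. v \<in> closure (span (e ` M)) \<Longrightarrow> (x - p) \<bullet> v = 0"
    by blast
  have "x \<bullet> e m = p \<bullet> e m" if "m \<in> M" for m
  proof -
    have "e m \<in> closure (span (e ` M))"
      using that by (intro subsetD[OF closure_subset] span_base) auto
    with p(2)[of "e m"] show ?thesis by (simp add: inner_diff_left)
  qed
  then have "component e M x = (\<Sum>\<^sub>\<infinity>m\<in>M. (p \<bullet> e m) *\<^sub>R e m)"
    unfolding component_def by (intro infsum_cong) simp
  \<comment> \<open>An infinite sum defaults to 0 when the family is not summable;
    \<open>has_sum\<close> guarantees that the value here is a genuine limit.\<close>
  also have "\<dots> = p"
    by (intro infsumI has_sum_orthonormal_expansion ortho p(1))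
  finally have "component e M x = p" .
  with p show "component e M x \<in> closed_subspace_gen e M"
    and "v \<in> closed_subspace_gen e M \<Longrightarrow> (x - component e M x) \<bullet> v = 0"
    by (auto simp: closed_subspace_gen_def)
qed

text \<open>Leaving \<open>p\<close> general covers two cases at once: \<open>p = x\<close> for
  points of the subspace, and \<open>p = component e M x\<close> for points outside it.\<close>

lemma metric_projection_ball_in_radial:
  assumes p: "p \<in> closed_subspace_gen e M"
    and orth: "\<And>v. v \<in> closed_subspace_gen e M \<Longrightarrow> (x - p) \<bullet> v = 0"
    and r: "r > 0" "r < norm p"
  shows "metric_projection (ball_in e M r) x = (r / norm p) *\<^sub>R p"
proof -
  define c where "c = r / norm p"
  have sub: "subspace (closed_subspace_gen e M)"
    by (simp add: closed_subspace_gen_def subspace_closure)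
  then have cp: "c *\<^sub>R p \<in> ball_in e M r"
    using p r by (auto simp: ball_in_def subspace_scale c_def)
  have "(x - c *\<^sub>R p) \<bullet> (z - c *\<^sub>R p) \<le> 0" if z: "z \<in> ball_in e M r" for z
  proof -
    from z have "z - c *\<^sub>R p \<in> closed_subspace_gen e M"
      using sub cp by (auto simp: ball_in_def subspace_diff)
    \<comment> \<open>The summand \<open>x - p\<close> is orthogonal to the subspace and drops out,
      which reduces the claim to the projection of \<open>p\<close>.\<close>
    then have "(x - c *\<^sub>R p) \<bullet> (z - c *\<^sub>R p) = (p - c *\<^sub>R p) \<bullet> (z - c *\<^sub>R p)"
      using orth[of "z - c *\<^sub>R p"] by (simp add: inner_diff_left)
    also have "\<dots> = (1 - c) * (p \<bullet> z - c * (norm p)\<^sup>2)"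
      unfolding power2_norm_eq_inner by (simp add: algebra_simps)
    also have "\<dots> \<le> 0"
    proof (rule mult_nonneg_nonpos)
      have "0 < norm p" using r by linarith
      with r(2) show "0 \<le> 1 - c" by (simp add: c_def)
      \<comment> \<open>The target bound is \<open>norm p * r\<close>, which equals
        \<open>c * (norm p)\<^sup>2\<close> by the choice of \<open>c\<close>.\<close>
      have "p \<bullet> z \<le> norm p * norm z" by (rule norm_cauchy_schwarz)
      also have "\<dots> \<le> norm p * r"
        using z by (intro mult_left_mono) (auto simp: ball_in_def)
      finally show "p \<bullet> z - c * (norm p)\<^sup>2 \<le> 0"
        using r by (simp add: c_def power2_eq_square mult.commute)
    qed
    finally show ?thesis .
  qed
  with cp show ?thesis
    unfolding c_def[symmetric] by (rule metric_projection_eqI)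
qed

theorem theorem6p1:
  fixes e :: "nat \<Rightarrow> 'a::{real_inner, complete_space}"
    and N M :: "nat set"
    and r :: real
    and x :: 'a
  assumes N_pos: "\<forall>n\<in>N. 0 < n"
    and N_card: "infinite N \<or> card N > 1"
    and basis: "orthonormal_basis N e"
    and M: "M \<noteq> {}" "M \<subseteq> N"
    and r: "r > 0"
  shows "(x \<in> ball_in e M r \<longrightarrow> metric_projection (ball_in e M r) x = x) \<and>
    (x \<in> closed_subspace_gen e M - ball_in e M r \<longrightarrow>
       metric_projection (ball_in e M r) x = (r / norm x) *\<^sub>R x) \<and>
    (x \<in> cylinder e M r - closed_subspace_gen e M \<longrightarrow>
       metric_projection (ball_in e M r) x = component e M x) \<and>
    (x \<in> UNIV - (cylinder e M r \<union> closed_subspace_gen e M) \<longrightarrow>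
       metric_projection (ball_in e M r) x = (r / norm (component e M x)) *\<^sub>R component e M x)"
proof (intro conjI impI)
  note comp = component_orthogonal_projection[OF basis M(2)]
  let ?p = "component e M x"
  show "metric_projection (ball_in e M r) x = x" if "x \<in> ball_in e M r"
    using that by (intro metric_projection_eqI) auto
  show "metric_projection (ball_in e M r) x = (r / norm x) *\<^sub>R x"
    if "x \<in> closed_subspace_gen e M - ball_in e M r"
    using that r by (intro metric_projection_ball_in_radial) (auto simp: ball_in_def)
  show "metric_projection (ball_in e M r) x = ?p"
    if "x \<in> cylinder e M r - closed_subspace_gen e M"
  proof (rule metric_projection_eqI)
    show "?p \<in> ball_in e M r"
      using that by (simp add: cylinder_def)
    \<comment> \<open>The inner product is in fact 0: \<open>x - ?p\<close> is orthogonal to both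
      \<open>z\<close> and \<open>?p\<close>.\<close>
    show "(x - ?p) \<bullet> (z - ?p) \<le> 0" if "z \<in> ball_in e M r" for z
      using that comp(2)[of z x] comp(2)[OF comp(1), of x x]
      by (simp add: ball_in_def inner_diff_right)
  qed
  \<comment> \<open>As \<open>?p\<close> always lies in the subspace, being outside the cylinder
    means precisely \<open>r < norm ?p\<close>.\<close>
  show "metric_projection (ball_in e M r) x = (r / norm ?p) *\<^sub>R ?p"
    if "x \<in> UNIV - (cylinder e M r \<union> closed_subspace_gen e M)"
    using that r comp
    by (intro metric_projection_ball_in_radial) (auto simp: cylinder_def ball_in_def)
qed

end
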